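(* Let $(\Omega,\mathcal{F},\mathbb{P})$ be a probability space, let $\mathcal{A}\subset L^\infty$ be an acceptance set and let $S=(S_0,S_1)$ be an eligible asset. Assume that $\mathcal{A}$ is pointed. Then $\rho_{\mathcal{A},S}$ is comonotonic only if \[ S_1=-\tfrac{S_0}{\rho_{\mathcal{A},S}(1)}. \] In particular, $\rho_{\mathcal{A},S}$ is never comonotonic if $S$ is a risky asset.
   Context: $L^\infty=L^\infty(\Omega,\mathcal{F},\mathbb{P})$ is the space of (a.s.-equivalence classes of) essentially bounded real random variables, with the essential supremum norm $\|\cdot\|$ and the almost sure order; $L^\infty_+=\{X\in L^\infty : X\ge 0\}$. Constants are identified with constant random variables. An acceptance set is a nonempty proper subset $\mathcal{A}\subset L^\infty$ that is norm-closed and increasing, i.e. $\mathcal{A}+L^\infty_+\subset\mathcal{A}$; it is pointed if $\mathcal{A}\cap(-\mathcal{A})\subset\{0\}$. An eligible asset is a pair $S=(S_0,S_1)\in(0,\infty)\times L^\infty_+$ with $S_1\ge\varepsilon$ a.s. for some constant $\varepsilon>0$; $S$ is risk-free if $S_1$ is (a.s.) constant, and risky otherwise. The associated risk measure is $\rho_{\mathcal{A},S}:L^\infty\to\mathbb{R}$, $\rho_{\mathcal{A},S}(X)=\inf\{m\in\mathbb{R} : X+\tfrac{m}{S_0}S_1\in\mathcal{A}\}$ (finitely valued under these assumptions). Two random variables $X,Y\in L^\infty$ are comonotone if there is a $\mathbb{P}\otimes\mathbb{P}$-null set $N$ such that $(X(\omega)-X(\omega'))(Y(\omega)-Y(\omega'))\ge0$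 for all $(\omega,\omega')\in(\Omega\times\Omega)\setminus N$. A functional $\rho:L^\infty\to\mathbb{R}$ is comonotonic if $\rho(X+Y)=\rho(X)+\rho(Y)$ for all comonotone $X,Y\in L^\infty$. *)

theory Defs
  imports "HOL-Probability.Probability"
begin

text \<open>Elements of the space of essentially bounded random variables are handled through
  representatives: measurable functions, with almost sure equality in the role of equality.\<close>

definition Linf :: "'a measure \<Rightarrow> ('a \<Rightarrow> real) set" where
  "Linf M = {X \<in> borel_measurable M. \<exists>c. AE \<omega> in M. \<bar>X \<omega>\<bar> \<le> c}"

definition Linf_pos :: "'a measure \<Rightarrow> ('a \<Rightarrow> real) set" where
  "Linf_pos M = {X \<in> Linf M. AE \<omega> in M. 0 \<le> X \<omega>}"

definition Linf_norm :: "'a measure \<Rightarrow> ('a \<Rightarrow> real) \<Rightarrow> real" where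
  "Linf_norm M X = real_of_ereal (esssup M (\<lambda>\<omega>. ereal \<bar>X \<omega>\<bar>))"

definition norm_closed :: "'a measure \<Rightarrow> ('a \<Rightarrow> real) set \<Rightarrow> bool" where
  "norm_closed M A \<longleftrightarrow>
     (\<forall>X \<in> Linf M. (\<forall>e>0. \<exists>Y \<in> A. Linf_norm M (\<lambda>\<omega>. X \<omega> - Y \<omega>) < e) \<longrightarrow> X \<in> A)"

text \<open>An acceptance set is automatically a union of almost-sure equivalence classes, see
  \<open>acceptance_set_AE_cong\<close> below.\<close>

definition acceptance_set :: "'a measure \<Rightarrow> ('a \<Rightarrow> real) set \<Rightarrow> bool" where
  "acceptance_set M A \<longleftrightarrow>
     A \<noteq> {} \<and> A \<subset> Linf M \<and> norm_closed M A \<and>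
     (\<forall>X \<in> A. \<forall>U \<in> Linf_pos M. (\<lambda>\<omega>. X \<omega> + U \<omega>) \<in> A)"

definition pointed :: "'a measure \<Rightarrow> ('a \<Rightarrow> real) set \<Rightarrow> bool" where
  "pointed M A \<longleftrightarrow> (\<forall>X. X \<in> A \<and> (\<lambda>\<omega>. - X \<omega>) \<in> A \<longrightarrow> (AE \<omega> in M. X \<omega> = 0))"

type_synonym 'a asset = "real \<times> ('a \<Rightarrow> real)"

definition eligible_asset :: "'a measure \<Rightarrow> 'a asset \<Rightarrow> bool" where
  "eligible_asset M S \<longleftrightarrow>
     fst S > 0 \<and> snd S \<in> Linf_pos M \<and> (\<exists>\<epsilon>>0. AE \<omega> in M. \<epsilon> \<le> snd S \<omega>)"

definition risk_free :: "'a measure \<Rightarrow> 'a asset \<Rightarrow> bool" where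
  "risk_free M S \<longleftrightarrow> (\<exists>c. AE \<omega> in M. snd S \<omega> = c)"

abbreviation risky :: "'a measure \<Rightarrow> 'a asset \<Rightarrow> bool" where
  "risky M S \<equiv> \<not> risk_free M S"

text \<open>For acceptance sets and eligible assets the infimum is over a nonempty set that is
  bounded below (\<open>risk_measure_set_nonempty\<close>, \<open>risk_measure_set_bdd_below\<close>), so that the
  infimum of real numbers is the intended one.\<close>

definition risk_measure :: "('a \<Rightarrow> real) set \<Rightarrow> 'a asset \<Rightarrow> ('a \<Rightarrow> real) \<Rightarrow> real" where
  "risk_measure A S X = Inf {m. (\<lambda>\<omega>. X \<omega> + m / fst S * snd S \<omega>) \<in> A}"

definition comonotone :: "'a measure \<Rightarrow> ('a \<Rightarrow> real) \<Rightarrow> ('a \<Rightarrow> real) \<Rightarrow> bool" where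
  "comonotone M X Y \<longleftrightarrow>
     (\<exists>N \<in> null_sets (M \<Otimes>\<^sub>M M). \<forall>(\<omega>, \<omega>') \<in> (space M \<times> space M) - N.
        (X \<omega> - X \<omega>') * (Y \<omega> - Y \<omega>') \<ge> 0)"

definition comonotonic :: "'a measure \<Rightarrow> (('a \<Rightarrow> real) \<Rightarrow> real) \<Rightarrow> bool" where
  "comonotonic M \<rho> \<longleftrightarrow>
     (\<forall>X \<in> Linf M. \<forall>Y \<in> Linf M. comonotone M X Y \<longrightarrow> \<rho> (\<lambda>\<omega>. X \<omega> + Y \<omega>) = \<rho> X + \<rho> Y)"

lemma Linf_lin:
  assumes "X \<in> Linf M" "Y \<in> Linf M"
  shows "(\<lambda>\<omega>. X \<omega> + a * Y \<omega>) \<in> Linf M"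
proof -
  obtain b c where b: "AE \<omega> in M. \<bar>X \<omega>\<bar> \<le> b" and c: "AE \<omega> in M. \<bar>Y \<omega>\<bar> \<le> c"
    using assms by (auto simp: Linf_def)
  have "AE \<omega> in M. \<bar>X \<omega> + a * Y \<omega>\<bar> \<le> b + \<bar>a\<bar> * c"
    using b c
  proof eventually_elim
    case (elim \<omega>)
    have "\<bar>X \<omega> + a * Y \<omega>\<bar> \<le> \<bar>X \<omega>\<bar> + \<bar>a\<bar> * \<bar>Y \<omega>\<bar>"
      using abs_triangle_ineq[of "X \<omega>" "a * Y \<omega>"] by (simp only: abs_mult)
    also have "\<dots> \<le> b + \<bar>a\<bar> * c"
      using elim by (intro add_mono mult_left_mono) auto
    finally show ?case .
  qed
  moreover have "(\<lambda>\<omega>. X \<omega> + a * Y \<omega>) \<in> borel_measurable M"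
    using assms by (intro borel_measurable_add borel_measurable_times borel_measurable_const) (simp_all add: Linf_def)
  ultimately show ?thesis
    unfolding Linf_def by blast
qed

lemma acceptance_set_mono:
  assumes A: "acceptance_set M A" and "Y \<in> A" "Z \<in> Linf M" "AE \<omega> in M. Y \<omega> \<le> Z \<omega>"
  shows "Z \<in> A"
proof -
  have "Y \<in> Linf M"
    using A \<open>Y \<in> A\<close> by (auto simp: acceptance_set_def)
  then have "(\<lambda>\<omega>. Z \<omega> - Y \<omega>) \<in> Linf M"
    using Linf_lin[OF assms(3), of Y "- 1"] by simp
  then have U: "(\<lambda>\<omega>. Z \<omega> - Y \<omega>) \<in> Linf_pos M"
    using assms(4) by (simp add: Linf_pos_def)
  have "\<And>X U. X \<in> A \<Longrightarrow> U \<in> Linf_pos M \<Longrightarrow> (\<lambda>\<omega>. X \<omega> + U \<omega>) \<in> A"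
    using A by (simp add: acceptance_set_def)
  from this[OF \<open>Y \<in> A\<close> U] show ?thesis by simp
qed

lemma acceptance_set_AE_cong:
  assumes "acceptance_set M A" "Y \<in> Linf M" "Z \<in> Linf M" "AE \<omega> in M. Y \<omega> = Z \<omega>"
  shows "Y \<in> A \<longleftrightarrow> Z \<in> A"
proof -
  have "AE \<omega> in M. Y \<omega> \<le> Z \<omega>" "AE \<omega> in M. Z \<omega> \<le> Y \<omega>"
    using assms(4) by (auto elim: eventually_mono)
  then show ?thesis
    using acceptance_set_mono[OF assms(1)] assms(2,3) by blast
qed

lemma risk_measure_AE_cong:
  assumes A: "acceptance_set M A" and S: "eligible_asset M S"
    and X: "X \<in> Linf M" "Y \<in> Linf M" "AE \<omega> in M. X \<omega> = Y \<omega>"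
  shows "risk_measure A S X = risk_measure A S Y"
proof -
  have "snd S \<in> Linf M"
    using S by (auto simp: eligible_asset_def Linf_pos_def)
  then have "((\<lambda>\<omega>. X \<omega> + m / fst S * snd S \<omega>) \<in> A) = ((\<lambda>\<omega>. Y \<omega> + m / fst S * snd S \<omega>) \<in> A)" for m
    using X by (intro acceptance_set_AE_cong[OF A] Linf_lin) auto
  then show ?thesis
    by (simp add: risk_measure_def)
qed

lemma risk_measure_set_nonempty:
  assumes A: "acceptance_set M A" and S: "eligible_asset M S" and X: "X \<in> Linf M"
  shows "{m. (\<lambda>\<omega>. X \<omega> + m / fst S * snd S \<omega>) \<in> A} \<noteq> {}"
proof -
  obtain Z where Z: "Z \<in> A" "Z \<in> Linf M"
    using A by (auto simp: acceptance_set_def)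
  obtain b c where b: "AE \<omega> in M. \<bar>X \<omega>\<bar> \<le> b" and c: "AE \<omega> in M. \<bar>Z \<omega>\<bar> \<le> c"
    using X Z by (auto simp: Linf_def)
  obtain e where e: "e > 0" "AE \<omega> in M. e \<le> snd S \<omega>" and S0: "fst S > 0"
    and S1: "snd S \<in> Linf M"
    using S by (auto simp: eligible_asset_def Linf_pos_def)
  define t where "t = (\<bar>b\<bar> + \<bar>c\<bar>) / e"
  have t: "t \<ge> 0" "t * e = \<bar>b\<bar> + \<bar>c\<bar>"
    using e by (auto simp: t_def)
  have "AE \<omega> in M. Z \<omega> \<le> X \<omega> + t * snd S \<omega>"
    using b c e(2)
  proof eventually_elim
    case (elim \<omega>)
    have "t * e \<le> t * snd S \<omega>"
      using elim t by (intro mult_left_mono) auto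
    then show ?case using elim t by linarith
  qed
  then have "(\<lambda>\<omega>. X \<omega> + t * snd S \<omega>) \<in> A"
    by (intro acceptance_set_mono[OF A Z(1)] Linf_lin X S1)
  then have "t * fst S \<in> {m. (\<lambda>\<omega>. X \<omega> + m / fst S * snd S \<omega>) \<in> A}"
    using S0 by simp
  then show ?thesis by blast
qed

lemma risk_measure_set_bdd_below:
  assumes A: "acceptance_set M A" and S: "eligible_asset M S" and X: "X \<in> Linf M"
  shows "bdd_below {m. (\<lambda>\<omega>. X \<omega> + m / fst S * snd S \<omega>) \<in> A}"
proof -
  obtain Z where Z: "Z \<notin> A" "Z \<in> Linf M"
    using A by (auto simp: acceptance_set_def)
  obtain b c where b: "AE \<omega> in M. \<bar>X \<omega>\<bar> \<le> b" and c: "AE \<omega> in M. \<bar>Z \<omega>\<bar> \<le> c"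
    using X Z by (auto simp: Linf_def)
  obtain e where e: "e > 0" "AE \<omega> in M. e \<le> snd S \<omega>" and S0: "fst S > 0"
    using S by (auto simp: eligible_asset_def)
  define t where "t = (\<bar>b\<bar> + \<bar>c\<bar>) / e"
  have t: "t \<ge> 0" "t * e = \<bar>b\<bar> + \<bar>c\<bar>"
    using e by (auto simp: t_def)
  have "- t * fst S \<le> m" if m: "(\<lambda>\<omega>. X \<omega> + m / fst S * snd S \<omega>) \<in> A" for m
  proof (rule ccontr)
    assume "\<not> - t * fst S \<le> m"
    then have m': "t \<le> - (m / fst S)"
      using S0 by (simp add: field_simps)
    have "AE \<omega> in M. X \<omega> + m / fst S * snd S \<omega> \<le> Z \<omega>"
      using b c e(2)
    proof eventually_elim
      case (elim \<omega>)
      have "t * e \<le> - (m / fst S) * snd S \<omega>"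
        using elim t e m' by (intro mult_mono) auto
      then show ?case using elim t by (simp only: mult_minus_left)
    qed
    then show False
      using acceptance_set_mono[OF A m Z(2)] Z(1) by simp
  qed
  then show ?thesis
    by (intro bdd_belowI[of _ "- t * fst S"]) simp
qed

end

theory Submission
  imports Defs
begin

text \<open>Constants are comonotone with each other, so comonotonicity forces \<open>\<rho>(-1) = -\<rho>(1)\<close>.
  By norm-closedness the infimum defining \<open>\<rho>\<close> is attained, hence both
  \<open>1 + \<rho>(1)/S\<^sub>0 S\<^sub>1\<close> and its negative are acceptable; pointedness makes it vanish.\<close>

lemma Linf_norm_le:
  assumes "X \<in> borel_measurable M" "AE \<omega> in M. \<bar>X \<omega>\<bar> \<le> c" "0 \<le> c"
  shows "Linf_norm M X \<le> c"
proof -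
  have "esssup M (\<lambda>\<omega>. ereal \<bar>X \<omega>\<bar>) \<le> ereal c"
    using assms(1,2) by (intro esssup_I) auto
  \<comment> \<open>The essential supremum may be \<open>-\<infinity>\<close>, as over a space of
    measure zero; \<open>real_of_ereal\<close> turns it into 0, and \<open>0 \<le> c\<close> covers
    this case.\<close>
  then show ?thesis
    using assms(3) unfolding Linf_norm_def
    by (cases "esssup M (\<lambda>\<omega>. ereal \<bar>X \<omega>\<bar>)") auto
qed

text \<open>Since \<open>snd S\<close> is essentially bounded, the position depends
  Lipschitz-continuously on \<open>m\<close> in norm. Acceptable positions with \<open>m\<close>
  close to the infimum thus approximate the one at the infimum.\<close>

lemma risk_measure_attained:
  assumes A: "acceptance_set M A" and S: "eligible_asset M S" and X: "X \<in> Linf M"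
  shows "(\<lambda>\<omega>. X \<omega> + risk_measure A S X / fst S * snd S \<omega>) \<in> A"
proof -
  let ?E = "{m. (\<lambda>\<omega>. X \<omega> + m / fst S * snd S \<omega>) \<in> A}"
  let ?r = "risk_measure A S X"
  have S0: "fst S > 0" and S1: "snd S \<in> Linf M"
    using S by (auto simp: eligible_asset_def Linf_pos_def)
  then have meas: "snd S \<in> borel_measurable M"
    by (simp add: Linf_def)
  obtain b' where "AE \<omega> in M. \<bar>snd S \<omega>\<bar> \<le> b'"
    using S1 by (auto simp: Linf_def)
  \<comment> \<open>The bound is enlarged to be strictly positive because \<open>d\<close> below
    divides by it.\<close>
  then have "AE \<omega> in M. \<bar>snd S \<omega>\<bar> \<le> \<bar>b'\<bar> + 1"
    by eventually_elim linarith
  moreover have "\<bar>b'\<bar> + 1 > 0"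
    by linarith
  ultimately obtain b where b: "AE \<omega> in M. \<bar>snd S \<omega>\<bar> \<le> b" and b_pos: "b > 0"
    by blast
  have "\<exists>Y\<in>A. Linf_norm M (\<lambda>\<omega>. X \<omega> + ?r / fst S * snd S \<omega> - Y \<omega>) < e" if "e > 0" for e
  proof -
    \<comment> \<open>Changing \<open>m\<close> by at most \<open>d\<close> moves the position by at
      most \<open>d / fst S * b = e / 2\<close> in norm, strictly below \<open>e\<close>.\<close>
    define d where "d = e * fst S / (2 * b)"
    have d: "d > 0"
      using that S0 b_pos by (simp add: d_def)
    have de: "d / fst S * b = e / 2"
      using S0 b_pos by (simp add: d_def)
    obtain m where m: "m \<in> ?E" "m < ?r + d"
      using cInf_lessD[OF risk_measure_set_nonempty[OF A S X], of "?r + d"] d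
      by (auto simp: risk_measure_def)
    have "?r \<le> m"
      unfolding risk_measure_def by (rule cInf_lower[OF m(1) risk_measure_set_bdd_below[OF A S X]])
    then have coeff: "\<bar>(?r - m) / fst S\<bar> \<le> d / fst S"
      using m(2) S0 by (simp add: divide_right_mono)
    let ?D = "\<lambda>\<omega>. X \<omega> + ?r / fst S * snd S \<omega> - (X \<omega> + m / fst S * snd S \<omega>)"
    have D: "?D = (\<lambda>\<omega>. (?r - m) / fst S * snd S \<omega>)"
      by (auto simp: diff_divide_distrib algebra_simps)
    have "AE \<omega> in M. \<bar>(?r - m) / fst S * snd S \<omega>\<bar> \<le> e / 2"
      using b
    proof eventually_elim
      case (elim \<omega>)
      show ?case
        unfolding abs_mult de[symmetric] using coeff elim d S0 by (intro mult_mono) auto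
    qed
    moreover have "(\<lambda>\<omega>. (?r - m) / fst S * snd S \<omega>) \<in> borel_measurable M"
      using meas by (intro borel_measurable_times) auto
    ultimately have "Linf_norm M ?D \<le> e / 2"
      unfolding D using that by (intro Linf_norm_le) auto
    then show ?thesis
      using m(1) that by (intro bexI[of _ "\<lambda>\<omega>. X \<omega> + m / fst S * snd S \<omega>"]) auto
  qed
  moreover have "norm_closed M A"
    using A by (simp add: acceptance_set_def)
  ultimately show ?thesis
    using bspec[OF _ Linf_lin[OF X S1, of "?r / fst S"]] unfolding norm_closed_def by auto
qed

lemma const_in_Linf: "(\<lambda>_. c) \<in> Linf M"
  by (auto simp: Linf_def)

lemma comonotonic_const_add:
  assumes "comonotonic M \<rho>"
  shows "\<rho> (\<lambda>_. a + b) = \<rho> (\<lambda>_. a) + \<rho> (\<lambda>_. b)"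
proof -
  have "comonotone M (\<lambda>_. a) (\<lambda>_. b)"
    \<comment> \<open>Differences of a constant vanish, so the product is 0 everywhere and the
      exceptional set can be empty.\<close>
    by (auto simp: comonotone_def intro: bexI[of _ "{}"])
  then show ?thesis
    using assms const_in_Linf unfolding comonotonic_def by blast
qed

text \<open>Additivity at \<open>0 + 0\<close> forces the value 0 at the zero position; additivity
  at \<open>a + (- a)\<close> then gives oddness.\<close>

lemma comonotonic_const_minus:
  assumes "comonotonic M \<rho>"
  shows "\<rho> (\<lambda>_. - a) = - \<rho> (\<lambda>_. a)"
  using comonotonic_const_add[OF assms, of a "- a"] comonotonic_const_add[OF assms, of 0 0]
  by simp

lemma comonotonic_imp_vanish:
  assumes A: "acceptance_set M A" and S: "eligible_asset M S"
    and "pointed M A" and \<rho>: "comonotonic M (risk_measure A S)"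
  shows "AE \<omega> in M. 1 + risk_measure A S (\<lambda>_. 1) / fst S * snd S \<omega> = 0"
proof -
  let ?X = "\<lambda>\<omega>. 1 + risk_measure A S (\<lambda>_. 1) / fst S * snd S \<omega>"
  have "?X \<in> A"
    using risk_measure_attained[OF A S const_in_Linf] .
  \<comment> \<open>The position attained for the constant \<open>- 1\<close> has the coefficient of
    \<open>1\<close> with opposite sign, so it is exactly the negative of \<open>?X\<close>.\<close>
  moreover have "(\<lambda>\<omega>. - ?X \<omega>) \<in> A"
    using risk_measure_attained[OF A S const_in_Linf, of "- 1"]
    by (simp add: comonotonic_const_minus[OF \<rho>])
  ultimately show ?thesis
    using assms(3) unfolding pointed_def by blast
qed

theorem corollary2p20:
  fixes M :: "'a measure" and A :: "('a \<Rightarrow> real) set" and S0 :: real and S1 :: "'a \<Rightarrow> real"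
  assumes "prob_space M"
    and "acceptance_set M A"
    and "eligible_asset M (S0, S1)"
    and "pointed M A"
  shows "(comonotonic M (risk_measure A (S0, S1)) \<longrightarrow>
            risk_measure A (S0, S1) (\<lambda>_. 1) \<noteq> 0 \<and>
            (AE \<omega> in M. S1 \<omega> = - (S0 / risk_measure A (S0, S1) (\<lambda>_. 1))))
       \<and> (risky M (S0, S1) \<longrightarrow> \<not> comonotonic M (risk_measure A (S0, S1)))"
proof -
  let ?r = "risk_measure A (S0, S1) (\<lambda>_. 1)"
  interpret prob_space M by fact
  have S0: "S0 > 0"
    using assms(3) by (simp add: eligible_asset_def)
  have main: "?r \<noteq> 0 \<and> (AE \<omega> in M. S1 \<omega> = - (S0 / ?r))"
    if "comonotonic M (risk_measure A (S0, S1))"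
  proof -
    have V: "AE \<omega> in M. 1 + ?r / S0 * S1 \<omega> = 0"
      using comonotonic_imp_vanish[OF assms(2,3,4) that] by simp
    \<comment> \<open>For \<open>?r = 0\<close> the identity \<open>V\<close> would read 1 = 0
      almost surely, which is impossible under a probability measure.\<close>
    then have r: "?r \<noteq> 0"
      by auto
    moreover have "AE \<omega> in M. S1 \<omega> = - (S0 / ?r)"
      using V
    proof eventually_elim
      case (elim \<omega>)
      then have "S0 + S1 \<omega> * ?r = 0"
        using S0 by (simp add: field_simps)
      then show ?case
        using r by (simp add: field_simps)
    qed
    ultimately show ?thesis by blast
  qed
  \<comment> \<open>By \<open>main\<close>, comonotonicity makes \<open>S1\<close> almost surely
    constant, that is, the asset risk-free; the second claim is the contrapositive.\<close>
  then show ?thesis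
    unfolding risk_free_def snd_conv by blast
qed

end
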